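(* Let $G$ be a subgroup of $\mathcal{S}_3$ and $\lambda\in\mathbb{K}$. Let $(A,\mu,R)$ be a Rota-Baxter $G$-associative algebra of weight $\lambda$. Suppose $\alpha\in Cent(A)$ is such that $\alpha$ and $R$ commute. Then $$A(n,m)=(A,\mu_{\alpha^n}=\alpha^n\mu,\alpha^m,R)$$ is a Rota-Baxter $G$-Hom-associative algebra of weight $\lambda$ for any $n,m\geq 0$.
   Context: $\mathbb{K}$ is a fixed field of characteristic $0$; all maps are $\mathbb{K}$-linear. A Hom-algebra $(A,\mu,\alpha)$ is a $\mathbb{K}$-module $A$ with a bilinear map $\mu\colon A\times A\to A$ and a linear map $\alpha\colon A\to A$. Its Hom-associator is $\mathfrak{as}_A(x_1,x_2,x_3)=\mu(\mu(x_1,x_2),\alpha(x_3))-\mu(\alpha(x_1),\mu(x_2,x_3))$. It is $G$-Hom-associative if $\sum_{\sigma\in G}(-1)^{\varepsilon(\sigma)}\mathfrak{as}_A(x_{\sigma(1)},x_{\sigma(2)},x_{\sigma(3)})=0$ for all $x_i\in A$, where $(-1)^{\varepsilon(\sigma)}$ is the signature of $\sigma$. A Rota-Baxter $G$-Hom-associative algebra of weight $\lambda$ is $(A,\mu,\alpha,R)$ where $(A,\mu,\alpha)$ is $G$-Hom-associative and $R\colon A\to A$ is linear with $\mu(R(x),R(y))=R(\mu(R(x),y)+\mu(x,R(y))+\lambda\mu(x,y))$ for all $x,y\in A$. A Rota-Baxter $G$-associative algebra $(A,\mu,R)$ is the case $\alpha=\mathrm{Id}$. The centroid $Cent(A)$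 is the set of linear maps $\alpha\colon A\to A$ with $\alpha(\mu(x,y))=\mu(\alpha(x),y)=\mu(x,\alpha(y))$ for all $x,y\in A$. *)

theory Defs
  imports Complex_Main "HOL-Algebra.Sym_Groups"
begin

locale hom_algebra = vector_space scale
  for scale :: "'k::field_char_0 \<Rightarrow> 'a::ab_group_add \<Rightarrow> 'a" +
  fixes \<mu> :: "'a \<Rightarrow> 'a \<Rightarrow> 'a"
    and \<alpha> :: "'a \<Rightarrow> 'a"
  assumes mult_linear_right: "Vector_Spaces.linear scale scale (\<lambda>y. \<mu> x y)"
    and mult_linear_left: "Vector_Spaces.linear scale scale (\<lambda>x. \<mu> x y)"
    and twist_linear: "Vector_Spaces.linear scale scale \<alpha>"

definition hom_associator ::
    "('a \<Rightarrow> 'a \<Rightarrow> 'a) \<Rightarrow> ('a \<Rightarrow> 'a) \<Rightarrow> 'a \<Rightarrow> 'a \<Rightarrow> 'a \<Rightarrow> 'a::ab_group_add"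
  where "hom_associator \<mu> \<alpha> x\<^sub>1 x\<^sub>2 x\<^sub>3 = \<mu> (\<mu> x\<^sub>1 x\<^sub>2) (\<alpha> x\<^sub>3) - \<mu> (\<alpha> x\<^sub>1) (\<mu> x\<^sub>2 x\<^sub>3)"

(* A triple is a family x of which only x 1, x 2, x 3 matter; elements of sym_group 3 are
   functions on nat that permute {1..3} and fix everything else. *)
locale G_hom_associative_algebra =
  hom_algebra scale \<mu> \<alpha>
  for G :: "(nat \<Rightarrow> nat) set"
    and scale :: "'k::field_char_0 \<Rightarrow> 'a::ab_group_add \<Rightarrow> 'a"
    and \<mu> :: "'a \<Rightarrow> 'a \<Rightarrow> 'a"
    and \<alpha> :: "'a \<Rightarrow> 'a" +
  assumes subgroup_G: "subgroup G (sym_group 3)"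
    and G_hom_associative:
      "(\<Sum>\<sigma>\<in>G. scale (of_int (sign \<sigma>)) (hom_associator \<mu> \<alpha> (x (\<sigma> 1)) (x (\<sigma> 2)) (x (\<sigma> 3)))) = 0"

locale rota_baxter_G_hom_associative_algebra =
  G_hom_associative_algebra G scale \<mu> \<alpha>
  for G :: "(nat \<Rightarrow> nat) set"
    and weight :: "'k::field_char_0"
    and scale :: "'k \<Rightarrow> 'a::ab_group_add \<Rightarrow> 'a"
    and \<mu> :: "'a \<Rightarrow> 'a \<Rightarrow> 'a"
    and \<alpha> :: "'a \<Rightarrow> 'a"
    and R :: "'a \<Rightarrow> 'a" +
  assumes R_linear: "Vector_Spaces.linear scale scale R"
    and rota_baxter: "\<mu> (R x) (R y) = R (\<mu> (R x) y + \<mu> x (R y) + scale weight (\<mu> x y))"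

abbreviation rota_baxter_G_associative_algebra ::
    "(nat \<Rightarrow> nat) set \<Rightarrow> 'k::field_char_0 \<Rightarrow> ('k \<Rightarrow> 'a::ab_group_add \<Rightarrow> 'a) \<Rightarrow> ('a \<Rightarrow> 'a \<Rightarrow> 'a) \<Rightarrow> ('a \<Rightarrow> 'a) \<Rightarrow> bool"
  where "rota_baxter_G_associative_algebra G weight scale \<mu> R \<equiv>
    rota_baxter_G_hom_associative_algebra G weight scale \<mu> id R"

definition centroid ::
    "('k::field_char_0 \<Rightarrow> 'a::ab_group_add \<Rightarrow> 'a) \<Rightarrow> ('a \<Rightarrow> 'a \<Rightarrow> 'a) \<Rightarrow> ('a \<Rightarrow> 'a) set"
  where "centroid scale \<mu> = {\<alpha>. Vector_Spaces.linear scale scale \<alpha> \<and>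
    (\<forall>x y. \<alpha> (\<mu> x y) = \<mu> (\<alpha> x) y \<and> \<alpha> (\<mu> x y) = \<mu> x (\<alpha> y))}"

end

theory Submission
  imports Defs
begin

text \<open>Elements of the centroid can be pulled out of any product, and powers of \<open>\<alpha>\<close> are again in
  the centroid. Hence the Hom-associator of \<open>A(n, m)\<close> is \<open>\<alpha>\<^sup>n\<alpha>\<^sup>n\<alpha>\<^sup>m\<close> applied to the associator of
  \<open>A\<close>, and the Rota-Baxter identity of \<open>A(n, m)\<close> is \<open>\<alpha>\<^sup>n\<close> applied to that of \<open>A\<close>.\<close>

text \<open>Both equations are oriented to move \<open>\<beta>\<close> out of the product, so they
  can serve as rewrite rules.\<close>

lemma centroidD:
  assumes "\<beta> \<in> centroid scale \<mu>"
  shows centroid_linear: "Vector_Spaces.linear scale scale \<beta>"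
    and centroid_mult_left: "\<mu> (\<beta> x) y = \<beta> (\<mu> x y)"
    and centroid_mult_right: "\<mu> x (\<beta> y) = \<beta> (\<mu> x y)"
  using assms unfolding centroid_def by simp_all metis+

text \<open>The centroid contains the identity and is closed under composition.\<close>

lemma funpow_centroid:
  assumes \<alpha>: "\<alpha> \<in> centroid scale \<mu>"
  shows "\<alpha> ^^ n \<in> centroid scale \<mu>"
proof (induction n)
  \<comment> \<open>The vector space laws for \<open>scale\<close>, on which linearity of the
    identity rests, come from the linearity of \<open>\<alpha>\<close>.\<close>
  interpret a: Vector_Spaces.linear scale scale \<alpha> using \<alpha> by (rule centroid_linear)
  case 0
  show ?case
    using a.vs1.linear_id by (simp add: centroid_def id_def)
next
  interpret a: Vector_Spaces.linear scale scale \<alpha> using \<alpha> by (rule centroid_linear)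
  case (Suc n)
  have "Vector_Spaces.linear scale scale (\<alpha> ^^ Suc n)"
    using Vector_Spaces.linear_compose[OF centroid_linear[OF Suc] a.linear_axioms] by simp
  then show ?case
    using centroid_mult_left[OF \<alpha>] centroid_mult_right[OF \<alpha>]
      centroid_mult_left[OF Suc] centroid_mult_right[OF Suc]
    by (simp add: centroid_def comp_def)
qed

lemma hom_associator_centroid:
  assumes \<beta>: "\<beta> \<in> centroid scale \<mu>" and \<gamma>: "\<gamma> \<in> centroid scale \<mu>"
  shows "hom_associator (\<lambda>x y. \<beta> (\<mu> x y)) \<gamma> x y z = \<beta> (\<beta> (\<gamma> (hom_associator \<mu> id x y z)))"
proof -
  interpret b: Vector_Spaces.linear scale scale \<beta> using \<beta> by (rule centroid_linear)
  interpret c: Vector_Spaces.linear scale scale \<gamma> using \<gamma> by (rule centroid_linear)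
  have "\<mu> (\<beta> u) (\<gamma> v) = \<beta> (\<gamma> (\<mu> u v))" for u v
    \<comment> \<open>Fixing \<open>u v\<close> in the rule for \<open>\<gamma>\<close> forces
      \<open>\<beta>\<close> to come out first, so both products end with the same order of
      \<open>\<beta>\<close> and \<open>\<gamma>\<close>.\<close>
    by (simp only: centroid_mult_left[OF \<beta>] centroid_mult_right[OF \<gamma>, of u v])
  moreover have "\<mu> (\<gamma> u) (\<beta> v) = \<beta> (\<gamma> (\<mu> u v))" for u v
    by (simp only: centroid_mult_right[OF \<beta>] centroid_mult_left[OF \<gamma>, of u v])
  ultimately show ?thesis
    by (simp add: hom_associator_def b.diff c.diff)
qed

text \<open>Abstracts the two powers to independent maps: \<open>\<beta>\<close> rescales the
  product, \<open>\<gamma>\<close> is the twist. Commutation with \<open>R\<close> concerns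
  \<open>\<beta>\<close>, as the Rota-Baxter identity involves only product and
  \<open>R\<close>.\<close>

lemma rota_baxter_G_hom_associative_algebra_centroid:
  assumes A: "rota_baxter_G_associative_algebra G weight scale \<mu> R"
    and \<beta>: "\<beta> \<in> centroid scale \<mu>" and \<gamma>: "\<gamma> \<in> centroid scale \<mu>"
    and comm: "\<beta> \<circ> R = R \<circ> \<beta>"
  shows "rota_baxter_G_hom_associative_algebra G weight scale (\<lambda>x y. \<beta> (\<mu> x y)) \<gamma> R"
proof -
  interpret A: rota_baxter_G_hom_associative_algebra G weight scale \<mu> id R by (fact A)
  interpret b: Vector_Spaces.linear scale scale \<beta> using \<beta> by (rule centroid_linear)
  interpret c: Vector_Spaces.linear scale scale \<gamma> using \<gamma> by (rule centroid_linear)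
  show ?thesis
  proof (intro rota_baxter_G_hom_associative_algebra.intro G_hom_associative_algebra.intro
      hom_algebra.intro rota_baxter_G_hom_associative_algebra_axioms.intro
      G_hom_associative_algebra_axioms.intro hom_algebra_axioms.intro)
    show "vector_space scale" ..
  next
    fix x y
    show "Vector_Spaces.linear scale scale (\<lambda>y. \<beta> (\<mu> x y))"
      using Vector_Spaces.linear_compose[OF A.mult_linear_right b.linear_axioms]
      by (simp add: comp_def)
    show "Vector_Spaces.linear scale scale (\<lambda>x. \<beta> (\<mu> x y))"
      using Vector_Spaces.linear_compose[OF A.mult_linear_left b.linear_axioms]
      by (simp add: comp_def)
    show "Vector_Spaces.linear scale scale \<gamma>"
      by (fact c.linear_axioms)
    show "Vector_Spaces.linear scale scale R"
      by (fact A.R_linear)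
    show "subgroup G (sym_group 3)"
      by (fact A.subgroup_G)
    \<comment> \<open>Lets \<open>\<beta>\<close> pass under the outer \<open>R\<close>, where
      linearity spreads it over the three summands.\<close>
    have "\<beta> (R z) = R (\<beta> z)" for z
      using comm by (simp add: fun_eq_iff)
    then show "\<beta> (\<mu> (R x) (R y)) =
        R (\<beta> (\<mu> (R x) y) + \<beta> (\<mu> x (R y)) + scale weight (\<beta> (\<mu> x y)))"
      by (simp add: A.rota_baxter b.add b.scale)
  next
    fix x
    \<comment> \<open>The linear map taken out of each associator does not depend on
      \<open>\<sigma>\<close>, so it factors out of the signed sum.\<close>
    have "(\<Sum>\<sigma>\<in>G. scale (of_int (sign \<sigma>))
          (hom_associator (\<lambda>x y. \<beta> (\<mu> x y)) \<gamma> (x (\<sigma> 1)) (x (\<sigma> 2)) (x (\<sigma> 3)))) =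
        \<beta> (\<beta> (\<gamma> (\<Sum>\<sigma>\<in>G. scale (of_int (sign \<sigma>))
          (hom_associator \<mu> id (x (\<sigma> 1)) (x (\<sigma> 2)) (x (\<sigma> 3))))))"
      by (simp only: hom_associator_centroid[OF \<beta> \<gamma>] b.sum c.sum b.scale c.scale)
    then show "(\<Sum>\<sigma>\<in>G. scale (of_int (sign \<sigma>))
        (hom_associator (\<lambda>x y. \<beta> (\<mu> x y)) \<gamma> (x (\<sigma> 1)) (x (\<sigma> 2)) (x (\<sigma> 3)))) = 0"
      by (simp only: A.G_hom_associative b.zero c.zero)
  qed
qed

theorem theorem3p13:
  fixes G :: "(nat \<Rightarrow> nat) set"
    and weight :: "'k::field_char_0"
    and scale :: "'k \<Rightarrow> 'a::ab_group_add \<Rightarrow> 'a"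
    and \<mu> :: "'a \<Rightarrow> 'a \<Rightarrow> 'a"
    and R \<alpha> :: "'a \<Rightarrow> 'a"
    and n m :: nat
  assumes "subgroup G (sym_group 3)"
    and "rota_baxter_G_associative_algebra G weight scale \<mu> R"
    and "\<alpha> \<in> centroid scale \<mu>"
    and "\<alpha> \<circ> R = R \<circ> \<alpha>"
  shows "rota_baxter_G_hom_associative_algebra G weight scale
           (\<lambda>x y. (\<alpha> ^^ n) (\<mu> x y)) (\<alpha> ^^ m) R"
proof -
  have "\<alpha> ^^ n \<circ> R = R \<circ> \<alpha> ^^ n"
    by (induction n) (use assms(4) in \<open>auto simp: fun_eq_iff\<close>)
  \<comment> \<open>One use of \<open>funpow_centroid\<close> per exponent: \<open>n\<close> for
    \<open>\<beta>\<close>, \<open>m\<close> for \<open>\<gamma>\<close>.\<close>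
  with assms(2) funpow_centroid[OF assms(3)] funpow_centroid[OF assms(3)] show ?thesis
    by (rule rota_baxter_G_hom_associative_algebra_centroid)
qed

end
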